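(* Let $m\ge 2$ be an integer, $\Gamma\subset\mathbb{N}_0$, $\Lambda\subset\mathbb{C}$, and let $S_{\{\mathbf a^{[k]},\,k\ge0\}}$ be a non-singular univariate $m$-ary subdivision scheme with symbols $a^{[k]}(z)$, $k\ge 0$. The scheme reproduces $EP_{\Gamma,\Lambda}$ if and only if there exists a shift parameter $\tau\in\mathbb{R}$ such that for all $k\ge0$, $\gamma\in\Gamma$, $\lambda\in\Lambda$ and $\epsilon\in\Xi$, with $v=\epsilon\, e^{-\lambda m^{-(k+1)}}$, $$ v^\gamma D^\gamma a^{[k]}(v)=\begin{cases} m\cdot v^{m\tau-\tau}\,q_\gamma(m\tau-\tau), & \text{if }\epsilon=1,\\ 0,&\text{otherwise.}\end{cases} $$
   Context: Scheme. For each $k\ge 0$ the mask $\mathbf a^{[k]}=\{a^{[k]}_\alpha:\alpha\in\mathbb{Z}\}$ is a real sequence supported in $[0,N_k]$ for some positive integer $N_k$, with symbol $a^{[k]}(z)=\sum_{\alpha\in\mathbb{Z}}a^{[k]}_\alpha z^\alpha$, $z\in\mathbb{C}\setminus\{0\}$. The subdivision operator is $(S_{\mathbf a^{[k]}}\mathbf f)_\alpha=\sum_{\beta\in\mathbb{Z}}a^{[k]}_{\alpha-m\beta}f_\beta$. The $m$-ary scheme $S_{\{\mathbf a^{[k]},k\ge 0\}}$ maps initial data $\mathbf f^{[0]}$ on $\mathbb{Z}$ to the sequences $\mathbf f^{[k+1]}=S_{\mathbf a^{[k]}}\mathbf f^{[k]}$, $k\ge 0$. Parametrization and convergence. For $\tau\in\mathbb{R}$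 (the shift parameter) let $t^{[k]}_\alpha=m^{-k}(\alpha+\tau)$. Let $F^{[k]}$ be a continuous function with $F^{[k]}(t^{[k]}_\alpha)=f^{[k]}_\alpha$ for all $\alpha$ (for definiteness, the piecewise linear interpolant). The scheme is convergent if for every initial data $\mathbf f^{[0]}$ there is a continuous limit function $g_{\mathbf f^{[0]}}$, nonzero for at least one $\mathbf f^{[0]}$, such that $F^{[k]}\to g_{\mathbf f^{[0]}}$ uniformly on compact sets; it is weakly convergent if $F^{[k]}\to g_{\mathbf f^{[0]}}$ pointwise with $g_{\mathbf f^{[0]}}$ locally bounded. For $\ell\ge0$, $g^{[\ell]}_{\mathbf f}$ denotes the limit function of the scheme with masks $\{\mathbf a^{[\ell+k]},k\ge 0\}$ applied to $\mathbf f$. The scheme is non-singular if for every $\ell\ge0$ the scheme with masks $\{\mathbf a^{[\ell+k]},k\ge 0\}$ is convergent (or weakly convergent) and $g^{[\ell]}_{\mathbf f}=0$ if and only if $\mathbf f=0$. Exponential polynomials and reproduction. $EP_{\Gamma,\Lambda}=\mathrm{span}\{x^\gamma e^{\lambda x}:\gamma\in\Gamma,\lambda\in\Lambda\}$. The scheme reproduces $EP_{\Gamma,\Lambda}$ if there exists $\tau\in\mathbb{R}$ such that for every $p\in EP_{\Gamma,\Lambda}$ and every $\ell\ge0$, with $\mathbf f^{[\ell]}=\{p(t^{[\ell]}_\alpha):\alpha\in\mathbb{Z}\}$, one has $\lim_{k\to\infty}S_{\mathbf a^{[\ell+k]}}\cdots S_{\mathbf a^{[\ell]}}\mathbf f^{[\ell]}=p$,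 where the sequence $S_{\mathbf a^{[\ell+k]}}\cdots S_{\mathbf a^{[\ell]}}\mathbf f^{[\ell]}$ is attached to the points $t^{[\ell+k+1]}_\alpha$ and the limit is in the sense of (weak) convergence above. Other notation. $\Xi=\{e^{2\pi i\varepsilon/m}:\varepsilon=0,\dots,m-1\}$ is the set of $m$-th roots of unity. $D^\gamma$ is the $\gamma$-th derivative. $q_0=1$, $q_\gamma(z)=\prod_{j=0}^{\gamma-1}(z-j)$. Powers with real exponents follow $(e^x)^y=e^{xy}$; thus for $\epsilon=1$, $v^{y}=e^{-\lambda m^{-(k+1)}y}$.
   Formalization: The direction from symbol conditions to reproduction is proved only for downward closed Γ (γ in Γ implies 0,…,γ in Γ), as it fails e.g. for Γ={1}, Λ={0}; necessity holds for every Γ. Non-singular is read as non-singular for every shift parameter τ. *)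

theory Defs
  imports "HOL-Analysis.Analysis" "HOL-Library.Function_Algebras"
begin

text \<open>A scheme of arity \<open>m\<close> is given by its level-dependent real masks \<open>a :: nat \<Rightarrow> int \<Rightarrow> real\<close>.
  Data sequences are complex valued, because exponential polynomials are.\<close>

definition scheme_masks :: "(nat \<Rightarrow> int \<Rightarrow> real) \<Rightarrow> bool" where
  "scheme_masks a \<longleftrightarrow>
     (\<forall>k. \<exists>N::nat. 0 < N \<and> (\<forall>\<alpha>. a k \<alpha> \<noteq> 0 \<longrightarrow> 0 \<le> \<alpha> \<and> \<alpha> \<le> int N))"

text \<open>The sums over all integers below are restricted to their nonzero terms; for a finitely
  supported mask the index sets are finite.\<close>

definition mask_symbol :: "(int \<Rightarrow> real) \<Rightarrow> complex \<Rightarrow> complex" where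
  "mask_symbol b z = (\<Sum>\<alpha> | b \<alpha> \<noteq> 0. of_real (b \<alpha>) * z powi \<alpha>)"

definition subdivision_op :: "nat \<Rightarrow> (int \<Rightarrow> real) \<Rightarrow> (int \<Rightarrow> complex) \<Rightarrow> int \<Rightarrow> complex" where
  "subdivision_op m b f \<alpha> =
     (\<Sum>\<beta> | b (\<alpha> - int m * \<beta>) \<noteq> 0. of_real (b (\<alpha> - int m * \<beta>)) * f \<beta>)"

primrec subdivide ::
  "nat \<Rightarrow> (nat \<Rightarrow> int \<Rightarrow> real) \<Rightarrow> (int \<Rightarrow> complex) \<Rightarrow> nat \<Rightarrow> int \<Rightarrow> complex" where
  "subdivide m a f 0 = f"
| "subdivide m a f (Suc k) = subdivision_op m (a k) (subdivide m a f k)"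

definition shifted_masks :: "nat \<Rightarrow> (nat \<Rightarrow> int \<Rightarrow> real) \<Rightarrow> nat \<Rightarrow> int \<Rightarrow> real" where
  "shifted_masks l a = (\<lambda>k. a (l + k))"

definition param_point :: "nat \<Rightarrow> real \<Rightarrow> nat \<Rightarrow> int \<Rightarrow> real" where
  "param_point m \<tau> k \<alpha> = (of_int \<alpha> + \<tau>) / of_nat m ^ k"

text \<open>The piecewise linear function with value \<open>f \<alpha>\<close> at each knot \<open>param_point m \<tau> k \<alpha>\<close>; the number
  \<open>m\<^sup>k x - \<tau>\<close> is the position of \<open>x\<close> in index units.\<close>

definition pl_interpolant :: "nat \<Rightarrow> real \<Rightarrow> nat \<Rightarrow> (int \<Rightarrow> complex) \<Rightarrow> real \<Rightarrow> complex" where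
  "pl_interpolant m \<tau> k f x =
     (let s = of_nat m ^ k * x - \<tau>
      in of_real (1 - frac s) * f \<lfloor>s\<rfloor> + of_real (frac s) * f (\<lfloor>s\<rfloor> + 1))"

definition converges_compactly :: "(nat \<Rightarrow> real \<Rightarrow> complex) \<Rightarrow> (real \<Rightarrow> complex) \<Rightarrow> bool" where
  "converges_compactly F g \<longleftrightarrow>
     continuous_on UNIV g \<and> (\<forall>K. compact K \<longrightarrow> uniform_limit K F g sequentially)"

definition converges_weakly :: "(nat \<Rightarrow> real \<Rightarrow> complex) \<Rightarrow> (real \<Rightarrow> complex) \<Rightarrow> bool" where
  "converges_weakly F g \<longleftrightarrow>
     (\<forall>x. (\<lambda>k. F k x) \<longlonglongrightarrow> g x) \<and> (\<forall>x. \<exists>r>0. bounded (g ` ball x r))"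

definition scheme_functions ::
  "nat \<Rightarrow> real \<Rightarrow> (nat \<Rightarrow> int \<Rightarrow> real) \<Rightarrow> (int \<Rightarrow> complex) \<Rightarrow> nat \<Rightarrow> real \<Rightarrow> complex" where
  "scheme_functions m \<tau> a f k = pl_interpolant m \<tau> k (subdivide m a f k)"

definition convergent_scheme :: "nat \<Rightarrow> real \<Rightarrow> (nat \<Rightarrow> int \<Rightarrow> real) \<Rightarrow> bool" where
  "convergent_scheme m \<tau> a \<longleftrightarrow>
     (\<forall>f. \<exists>g. converges_compactly (scheme_functions m \<tau> a f) g) \<and>
     (\<exists>f g. converges_compactly (scheme_functions m \<tau> a f) g \<and> (\<exists>x. g x \<noteq> 0))"

definition weakly_convergent_scheme :: "nat \<Rightarrow> real \<Rightarrow> (nat \<Rightarrow> int \<Rightarrow> real) \<Rightarrow> bool" where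
  "weakly_convergent_scheme m \<tau> a \<longleftrightarrow>
     (\<forall>f. \<exists>g. converges_weakly (scheme_functions m \<tau> a f) g)"

text \<open>Both modes of convergence imply pointwise convergence, so the pointwise limit is the limit
  function in either case.\<close>

definition limit_function ::
  "nat \<Rightarrow> real \<Rightarrow> (nat \<Rightarrow> int \<Rightarrow> real) \<Rightarrow> (int \<Rightarrow> complex) \<Rightarrow> real \<Rightarrow> complex" where
  "limit_function m \<tau> a f x = lim (\<lambda>k. scheme_functions m \<tau> a f k x)"

text \<open>Non-singularity refers to the parametrization with shift \<open>\<tau>\<close>. Uniform convergence on compact
  sets and its limit do not depend on \<open>\<tau>\<close>, but pointwise limits do: the masks
  \<open>a\<^sub>0 = 1\<close>, \<open>a\<^sub>\<alpha> = 0\<close> otherwise, are (weakly) non-singular for \<open>\<tau> = 0\<close>, whereas all their limits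
  are \<open>0\<close> for \<open>\<tau> = 2\<close>.\<close>

definition non_singular_scheme :: "nat \<Rightarrow> real \<Rightarrow> (nat \<Rightarrow> int \<Rightarrow> real) \<Rightarrow> bool" where
  "non_singular_scheme m \<tau> a \<longleftrightarrow>
     (\<forall>l. (convergent_scheme m \<tau> (shifted_masks l a) \<or>
           weakly_convergent_scheme m \<tau> (shifted_masks l a)) \<and>
          (\<forall>f. limit_function m \<tau> (shifted_masks l a) f = (\<lambda>x. 0) \<longleftrightarrow> f = (\<lambda>\<alpha>. 0)))"

definition EP :: "nat set \<Rightarrow> complex set \<Rightarrow> (real \<Rightarrow> complex) set" where
  "EP \<Gamma> \<Lambda> = module.span (\<lambda>(c::complex) p x. c * p x)
     {(\<lambda>x. of_real x ^ \<gamma> * exp (\<mu> * of_real x)) | \<gamma> \<mu>. \<gamma> \<in> \<Gamma> \<and> \<mu> \<in> \<Lambda>}"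

text \<open>The library's span is defined inside a locale; the following shows that the complex-valued
  functions with pointwise operations are an instance of it.\<close>

lemma module_complex_functions:
  "module (\<lambda>(c::complex) (p :: real \<Rightarrow> complex) x. c * p x)"
  by unfold_locales (auto simp: fun_eq_iff algebra_simps)

text \<open>The data produced from level \<open>l\<close> by \<open>k + 1\<close> steps are attached to the points of level
  \<open>l + k + 1\<close>.\<close>

definition reproduces_EP ::
  "nat \<Rightarrow> (nat \<Rightarrow> int \<Rightarrow> real) \<Rightarrow> nat set \<Rightarrow> complex set \<Rightarrow> bool" where
  "reproduces_EP m a \<Gamma> \<Lambda> \<longleftrightarrow>
     (\<exists>\<tau>. \<forall>p \<in> EP \<Gamma> \<Lambda>. \<forall>l.
        converges_weakly
          (\<lambda>k. pl_interpolant m \<tau> (l + k + 1)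
                 (subdivide m (shifted_masks l a) (\<lambda>\<alpha>. p (param_point m \<tau> l \<alpha>)) (k + 1)))
          p)"

definition unity_roots :: "nat \<Rightarrow> complex set" where
  "unity_roots m = {exp (2 * of_real pi * \<i> * of_nat j / of_nat m) | j. j < m}"

definition q_poly :: "nat \<Rightarrow> real \<Rightarrow> real" where
  "q_poly \<gamma> z = (\<Prod>j<\<gamma>. z - of_nat j)"

text \<open>For \<open>\<epsilon> = 1\<close> the power \<open>v\<^sup>y\<close> with the real exponent \<open>y = m\<tau> - \<tau>\<close> is read as
  \<open>exp (-\<mu> m\<^sup>-\<^sup>(\<^sup>k\<^sup>+\<^sup>1\<^sup>) y)\<close>, not as the principal branch of \<open>v powr y\<close>.\<close>

definition symbol_conditions ::
  "nat \<Rightarrow> (nat \<Rightarrow> int \<Rightarrow> real) \<Rightarrow> nat set \<Rightarrow> complex set \<Rightarrow> real \<Rightarrow> bool" where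
  "symbol_conditions m a \<Gamma> \<Lambda> \<tau> \<longleftrightarrow>
     (\<forall>k. \<forall>\<gamma>\<in>\<Gamma>. \<forall>\<mu>\<in>\<Lambda>. \<forall>\<epsilon>\<in>unity_roots m.
        let v = \<epsilon> * exp (- \<mu> / of_nat m ^ (k + 1));
            y = of_nat m * \<tau> - \<tau>
        in v ^ \<gamma> * (deriv ^^ \<gamma>) (mask_symbol (a k)) v =
             (if \<epsilon> = 1
              then of_nat m * exp (- \<mu> / of_nat m ^ (k + 1) * of_real y) * of_real (q_poly \<gamma> y)
              else 0))"

end

theory Submission
  imports Defs "HOL-Computational_Algebra.Polynomial"
begin

text \<open>Reproduction and the symbol conditions are two descriptions of one property: on every residue
  class modulo \<open>m\<close>, the mask entries, weighted by exponentials, form a quadrature rule for evaluation of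
  polynomials at \<open>y = m\<tau> - \<tau>\<close>.

  Reproduction in the limit is the same as reproduction in each single step. If \<open>p\<close> is the limit
  from the samples of \<open>p\<close> at every level, then one subdivision step applied to the samples at
  level \<open>l\<close>, and the samples at level \<open>l + 1\<close>, are data of level \<open>l + 1\<close> with the same limit
  function. Their difference has limit \<open>0\<close>, so it vanishes by non-singularity
  (\<open>reproduced_imp_step_reproduces\<close>). Conversely, if every step maps samples of a continuous \<open>p\<close> to
  samples of \<open>p\<close>, then the piecewise linear interpolants tend to \<open>p\<close>
  (\<open>step_reproduces_imp_converges_weakly\<close>).

  For \<open>p(x) = x\<^sup>\<gamma> exp (\<mu> x)\<close>, put \<open>\<nu> = \<mu> / m\<^sup>k\<^sup>+\<^sup>1\<close>. After a common exponential factor is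
  cancelled, the step at level \<open>k\<close> at the index \<open>\<alpha>\<close> says that
  \<open>\<Sum>\<^sub>n c\<^sub>n (s - n)\<^sup>\<gamma> = (s - y)\<^sup>\<gamma>\<close> with \<open>c\<^sub>n = a\<^sub>n exp (- \<nu> (n - y))\<close> and \<open>s = \<alpha> + m\<tau>\<close>, where \<open>n\<close> runs
  through the residue class of \<open>\<alpha>\<close> (\<open>exp_monomial_step_iff\<close>). As \<open>\<alpha>\<close> runs through a residue class,
  this is an identity of polynomials in \<open>s\<close>, and comparing coefficients shows that
  \<open>\<Sum>\<^sub>n c\<^sub>n P(n) = P(y)\<close> for all polynomials \<open>P\<close> of degree at most \<open>\<gamma>\<close>
  (\<open>exact_to_degree_shifted_powers\<close>).

  On the other side, \<open>v\<^sup>\<gamma> D\<^sup>\<gamma> a(v)\<close> is the sum of \<open>a\<^sub>n q\<^sub>\<gamma>(n) v\<^sup>n\<close>. Prescribing its values at all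
  \<open>v = \<epsilon> exp (- \<nu>)\<close> with \<open>\<epsilon>\<^sup>m = 1\<close> amounts, by the discrete Fourier transform, to prescribing the
  sums of \<open>a\<^sub>n q\<^sub>\<gamma>(n) exp (- \<nu> n)\<close> over the single residue classes, all with the same value
  (\<open>residue_class_sums_iff\<close>). The symbol condition
  of order \<open>\<gamma>\<close> is therefore exactness of the rules for the single polynomial \<open>q\<^sub>\<gamma>\<close>. Exactness up to
  degree \<open>\<gamma>\<close> implies it; conversely the conditions of all orders \<open>j \<le> \<gamma>\<close> imply exactness up to
  degree \<open>\<gamma>\<close>, because \<open>q\<^sub>0, \<dots>, q\<^sub>\<gamma>\<close> is a basis. Here the
  downward closure of \<open>\<Gamma>\<close> enters.\<close>

section \<open>Quadrature rules on the nonnegative integers\<close>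

definition exact_to_degree :: "nat set \<Rightarrow> (nat \<Rightarrow> complex) \<Rightarrow> complex \<Rightarrow> nat \<Rightarrow> bool" where
  "exact_to_degree S c y d \<longleftrightarrow>
     (\<forall>p. degree p \<le> d \<longrightarrow> (\<Sum>n\<in>S. c n * poly p (of_nat n)) = poly p y)"

text \<open>One polynomial of each degree \<open>j \<le> d\<close> suffices, since these form a basis.\<close>

lemma exact_to_degree_staircase:
  assumes deg: "\<And>j. j \<le> d \<Longrightarrow> degree (Q j) = j \<and> Q j \<noteq> 0"
    and exact: "\<And>j. j \<le> d \<Longrightarrow> (\<Sum>n\<in>S. c n * poly (Q j) (of_nat n)) = poly (Q j) y"
  shows "exact_to_degree S c y d"
  unfolding exact_to_degree_def
proof (intro allI impI)
  fix p :: "complex poly"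
  assume "degree p \<le> d"
  then show "(\<Sum>n\<in>S. c n * poly p (of_nat n)) = poly p y"
  proof (induction "degree p" arbitrary: p rule: less_induct)
    case less
    define e where "e = degree p"
    define t where "t = lead_coeff p / lead_coeff (Q e)"
    define r where "r = p - smult t (Q e)"
    have Qe: "degree (Q e) = e" "Q e \<noteq> 0"
      using deg[of e] less.prems by (auto simp: e_def)
    have dr: "degree r \<le> e"
      unfolding r_def
      by (rule degree_diff_le) (use Qe degree_smult_le[of t "Q e"] in \<open>auto simp: e_def\<close>)
    have "coeff r e = 0"
      using Qe leading_coeff_neq_0[of "Q e"] by (simp add: r_def t_def e_def[symmetric])
    then have "r = 0 \<or> degree r < e"
      using dr by (metis le_neq_implies_less leading_coeff_0_iff)
    then have "(\<Sum>n\<in>S. c n * poly r (of_nat n)) = poly r y"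
      using less.hyps[of r] less.prems by (auto simp: e_def)
    moreover have "(\<Sum>n\<in>S. c n * poly (Q e) (of_nat n)) = poly (Q e) y"
      using exact[of e] less.prems by (simp add: e_def)
    moreover have p: "p = r + smult t (Q e)"
      by (simp add: r_def)
    have "(\<Sum>n\<in>S. c n * poly p (of_nat n))
        = (\<Sum>n\<in>S. c n * poly r (of_nat n)) + t * (\<Sum>n\<in>S. c n * poly (Q e) (of_nat n))"
      unfolding p by (simp add: sum.distrib sum_distrib_left algebra_simps)
    ultimately show ?case
      by (subst (2) p) simp
  qed
qed

text \<open>The hypothesis involves only shifts of the power \<open>x\<^sup>d\<close>, but infinitely many of them. It is an
  identity of polynomials in \<open>s\<close>, and its coefficient of \<open>s\<^sup>d\<^sup>-\<^sup>j\<close> is a nonzero binomial coefficient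
  times the exactness condition for \<open>(- x)\<^sup>j\<close>.\<close>

lemma exact_to_degree_shifted_powers:
  assumes "infinite A"
    and eq: "\<And>s. s \<in> A \<Longrightarrow> (\<Sum>n\<in>S. c n * (s - of_nat n) ^ d) = (s - y) ^ d"
  shows "exact_to_degree S c y d"
proof -
  define R where "R = (\<Sum>n\<in>S. smult (c n) ([:- of_nat n, 1:] ^ d)) - [:- y, 1:] ^ d"
  have "A \<subseteq> {s. poly R s = 0}"
    using eq by (auto simp: R_def poly_sum)
  with \<open>infinite A\<close> have "R = 0"
    using poly_roots_finite finite_subset by blast
  have mom: "(\<Sum>n\<in>S. c n * (- of_nat n) ^ j) = (- y) ^ j" if "j \<le> d" for j
  proof -
    have "coeff R (d - j) = 0"
      using \<open>R = 0\<close> by simp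
    then have "of_nat (d choose (d - j)) * (\<Sum>n\<in>S. c n * (- of_nat n) ^ j)
             = of_nat (d choose (d - j)) * (- y) ^ j"
      using that
      by (simp add: R_def coeff_sum coeff_linear_poly_power sum_distrib_left mult_ac)
    moreover have "of_nat (d choose (d - j)) \<noteq> (0 :: complex)"
      by (simp add: not_less)
    ultimately show ?thesis
      by simp
  qed
  show ?thesis
  proof (rule exact_to_degree_staircase[where Q = "\<lambda>j. [:0, - 1:] ^ j"])
    show "degree ([:0, - 1:] ^ j :: complex poly) = j \<and> [:0, - 1:] ^ j \<noteq> (0 :: complex poly)" for j
      by (simp add: degree_power_eq)
  qed (use mom in simp)
qed

section \<open>Roots of unity and residue classes\<close>

definition residue_upto :: "nat \<Rightarrow> nat \<Rightarrow> nat \<Rightarrow> nat set" where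
  "residue_upto N m r = {n. n \<le> N \<and> n mod m = r}"

lemma finite_residue_upto [simp]: "finite (residue_upto N m r)"
  by (rule finite_subset[of _ "{..N}"]) (auto simp: residue_upto_def)

lemma unity_roots_eq: "1 \<le> m \<Longrightarrow> unity_roots m = {z. z ^ m = 1}"
  unfolding unity_roots_def by (rule complex_roots_unity[symmetric])

lemma sum_unity_roots_power:
  assumes "1 \<le> m"
  shows "(\<Sum>\<epsilon>\<in>unity_roots m. \<epsilon> ^ n) = (if m dvd n then of_nat m else 0)"
proof (cases "m dvd n")
  case True
  then have "(\<Sum>\<epsilon>\<in>unity_roots m. \<epsilon> ^ n) = (\<Sum>\<epsilon>\<in>unity_roots m. 1)"
    by (intro sum.cong) (auto simp: unity_roots_eq[OF assms] power_mult)
  then show ?thesis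
    using True assms card_complex_roots_unity_explicit[of m] by (simp add: unity_roots_def)
next
  case False
  define \<omega> where "\<omega> = exp (2 * of_real pi * \<i> * of_nat 1 / of_nat m :: complex)"
  have \<omega>: "\<omega> ^ m = 1"
    unfolding \<omega>_def using complex_root_unity[of m 1] assms by simp
  have ne: "\<omega> ^ n \<noteq> 1"
  proof
    assume "\<omega> ^ n = 1"
    then have "exp (2 * of_real pi * \<i> * of_nat n / of_nat m) = (1 :: complex)"
      by (simp add: \<omega>_def exp_of_nat_mult[symmetric] mult_ac)
    then have "m dvd n"
      using complex_root_unity_eq_1[of m n] assms by simp
    with False show False by simp
  qed
  \<comment> \<open>Multiplication by a primitive root permutes the roots and scales the sum by a factor
    different from 1.\<close>
  have "bij_betw ((*) \<omega>) (unity_roots m) (unity_roots m)"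
    by (rule bij_betwI[where g = "(*) (inverse \<omega>)"])
       (use \<omega> assms in \<open>auto simp: unity_roots_eq power_mult_distrib power_inverse \<omega>_def\<close>)
  then have "(\<Sum>\<epsilon>\<in>unity_roots m. \<epsilon> ^ n) = (\<Sum>\<epsilon>\<in>unity_roots m. (\<omega> * \<epsilon>) ^ n)"
    by (rule sum.reindex_bij_betw[symmetric])
  also have "\<dots> = \<omega> ^ n * (\<Sum>\<epsilon>\<in>unity_roots m. \<epsilon> ^ n)"
    by (simp add: power_mult_distrib sum_distrib_left)
  finally have "(\<omega> ^ n - 1) * (\<Sum>\<epsilon>\<in>unity_roots m. \<epsilon> ^ n) = 0"
    by (simp add: algebra_simps)
  with ne False show ?thesis by simp
qed

text \<open>The discrete Fourier transform on the residues: the values at the roots of unity are the transform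
  of the vector of class sums, and a vector is constant if and only if its transform vanishes away
  from \<open>\<epsilon> = 1\<close>.\<close>

lemma residue_class_sums_iff:
  assumes "1 \<le> m"
  shows "(\<forall>\<epsilon>\<in>unity_roots m. (\<Sum>n\<le>N. d n * \<epsilon> ^ n) = (if \<epsilon> = 1 then of_nat m * T else 0)) \<longleftrightarrow>
         (\<forall>r<m. (\<Sum>n\<in>residue_upto N m r. d n) = T)"
    (is "?L \<longleftrightarrow> ?R")
proof
  assume L: ?L
  show ?R
  proof (intro allI impI)
    \<comment> \<open>Fourier inversion; \<open>\<epsilon>\<^sup>m\<^sup>-\<^sup>r\<close> serves as the inverse of \<open>\<epsilon>\<^sup>r\<close>.\<close>
    fix r assume r: "r < m"
    have div: "m dvd n + (m - r) \<longleftrightarrow> n mod m = r" for n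
    proof -
      have "m dvd n + (m - r) \<longleftrightarrow> int m dvd int n - int r + int m"
        using r by (subst int_dvd_int_iff[symmetric]) (simp add: of_nat_diff algebra_simps)
      also have "\<dots> \<longleftrightarrow> int n mod int m = int r mod int m"
        by (simp add: mod_eq_dvd_iff)
      also have "\<dots> \<longleftrightarrow> n mod m = r"
        using r by (metis mod_less of_nat_eq_iff of_nat_mod)
      finally show ?thesis .
    qed
    have "of_nat m * T = (\<Sum>\<epsilon>\<in>unity_roots m. if \<epsilon> = 1 then of_nat m * T else 0)"
      by (subst sum.delta) (auto simp: unity_roots_eq[OF assms] finite_roots_unity[OF assms])
    also have "\<dots> = (\<Sum>\<epsilon>\<in>unity_roots m. \<epsilon> ^ (m - r) * (\<Sum>n\<le>N. d n * \<epsilon> ^ n))"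
      by (intro sum.cong) (use L in auto)
    also have "\<dots> = (\<Sum>n\<le>N. d n * (\<Sum>\<epsilon>\<in>unity_roots m. \<epsilon> ^ (n + (m - r))))"
      unfolding sum_distrib_left by (subst sum.swap) (simp add: power_add mult_ac)
    also have "\<dots> = (\<Sum>n\<le>N. if n mod m = r then of_nat m * d n else 0)"
      by (intro sum.cong) (auto simp: sum_unity_roots_power[OF assms] div)
    also have "\<dots> = of_nat m * (\<Sum>n\<in>residue_upto N m r. d n)"
      unfolding residue_upto_def
      by (subst sum.inter_filter[symmetric]) (auto simp: sum_distrib_left intro!: sum.cong)
    finally show "(\<Sum>n\<in>residue_upto N m r. d n) = T"
      using assms by simp
  qed
next
  assume R: ?R
  show ?L
  proof
    fix \<epsilon> assume "\<epsilon> \<in> unity_roots m"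
    then have \<epsilon>: "\<epsilon> ^ m = 1"
      by (simp add: unity_roots_eq[OF assms])
    have "(\<Sum>n\<le>N. d n * \<epsilon> ^ n) = (\<Sum>r<m. \<Sum>n | n \<in> {..N} \<and> n mod m = r. d n * \<epsilon> ^ n)"
      by (rule sum.group[symmetric]) (use assms in auto)
    also have "\<dots> = (\<Sum>r<m. \<epsilon> ^ r * (\<Sum>n\<in>residue_upto N m r. d n))"
    proof (intro sum.cong refl)
      fix r
      have "\<epsilon> ^ n = \<epsilon> ^ (n mod m)" for n
        by (metis \<epsilon> mult.left_neutral power_add power_mult power_one div_mult_mod_eq mult.commute)
      then show "(\<Sum>n | n \<in> {..N} \<and> n mod m = r. d n * \<epsilon> ^ n)
          = \<epsilon> ^ r * (\<Sum>n\<in>residue_upto N m r. d n)"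
        unfolding sum_distrib_left residue_upto_def
        by (intro sum.cong) (auto simp: mult.commute)
    qed
    also have "\<dots> = (\<Sum>r<m. \<epsilon> ^ r) * T"
      using R by (simp add: sum_distrib_right)
    also have "(\<Sum>r<m. \<epsilon> ^ r) = (if \<epsilon> = 1 then of_nat m else 0)"
      using \<epsilon> by (simp add: sum_gp_strict)
    finally show "(\<Sum>n\<le>N. d n * \<epsilon> ^ n) = (if \<epsilon> = 1 then of_nat m * T else 0)"
      by simp
  qed
qed

section \<open>The symbol of a finitely supported mask\<close>

definition mask_supported :: "(int \<Rightarrow> real) \<Rightarrow> nat \<Rightarrow> bool" where
  "mask_supported b N \<longleftrightarrow> (\<forall>\<alpha>. b \<alpha> \<noteq> 0 \<longrightarrow> 0 \<le> \<alpha> \<and> \<alpha> \<le> int N)"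

definition falling_poly :: "nat \<Rightarrow> complex poly" where
  "falling_poly \<gamma> = (\<Prod>j<\<gamma>. [:- of_nat j, 1:])"

lemma falling_poly_Suc: "falling_poly (Suc \<gamma>) = falling_poly \<gamma> * [:- of_nat \<gamma>, 1:]"
  unfolding falling_poly_def by (rule prod.lessThan_Suc)

lemma degree_falling_poly: "degree (falling_poly \<gamma>) = \<gamma> \<and> falling_poly \<gamma> \<noteq> 0"
  unfolding falling_poly_def by (subst degree_prod_sum_eq) auto

lemma poly_falling_poly_of_real: "poly (falling_poly \<gamma>) (of_real y) = of_real (q_poly \<gamma> y)"
  by (simp add: falling_poly_def q_poly_def poly_prod)

lemma poly_falling_poly_eq_0: "n < \<gamma> \<Longrightarrow> poly (falling_poly \<gamma>) (of_nat n) = 0"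
  by (auto simp: falling_poly_def poly_prod)

lemma mask_symbol_eq:
  assumes "mask_supported b N"
  shows "mask_symbol b = (\<lambda>z. \<Sum>n\<le>N. of_real (b (int n)) * z ^ n)"
proof
  fix z
  have "mask_symbol b z = (\<Sum>\<alpha>\<in>int ` {..N}. of_real (b \<alpha>) * z powi \<alpha>)"
    unfolding mask_symbol_def
  proof (rule sum.mono_neutral_left)
    show "{\<alpha>. b \<alpha> \<noteq> 0} \<subseteq> int ` {..N}"
    proof
      fix \<alpha> assume "\<alpha> \<in> {\<alpha>. b \<alpha> \<noteq> 0}"
      then have "0 \<le> \<alpha>" "\<alpha> \<le> int N"
        using assms by (auto simp: mask_supported_def)
      then have "\<alpha> = int (nat \<alpha>)" "nat \<alpha> \<in> {..N}" by auto
      then show "\<alpha> \<in> int ` {..N}" by blast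
    qed
  qed auto
  then show "mask_symbol b z = (\<Sum>n\<le>N. of_real (b (int n)) * z ^ n)"
    by (simp add: sum.reindex)
qed

text \<open>Differentiating \<open>z\<^sup>n\<close> exactly \<open>\<gamma>\<close> times produces the falling factorial \<open>q\<^sub>\<gamma>(n)\<close>; as it vanishes for
  \<open>n < \<gamma>\<close>, the truncated exponent \<open>n - \<gamma>\<close> is harmless.\<close>

lemma power_mult_higher_deriv_symbol:
  assumes "mask_supported b N"
  shows "v ^ \<gamma> * (deriv ^^ \<gamma>) (mask_symbol b) v
       = (\<Sum>n\<le>N. of_real (b (int n)) * poly (falling_poly \<gamma>) (of_nat n) * v ^ n)"
proof -
  have "(deriv ^^ \<gamma>) (mask_symbol b)
      = (\<lambda>z. \<Sum>n\<le>N. of_real (b (int n)) * poly (falling_poly \<gamma>) (of_nat n) * z ^ (n - \<gamma>))"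
  proof (induction \<gamma>)
    case 0
    show ?case
      by (simp add: mask_symbol_eq[OF assms] falling_poly_def)
  next
    case (Suc \<gamma>)
    have "deriv (\<lambda>z. \<Sum>n\<le>N. of_real (b (int n)) * poly (falling_poly \<gamma>) (of_nat n) * z ^ (n - \<gamma>)) z
        = (\<Sum>n\<le>N. of_real (b (int n)) * poly (falling_poly (Suc \<gamma>)) (of_nat n) * z ^ (n - Suc \<gamma>))"
      for z :: complex
    proof (rule DERIV_imp_deriv, rule DERIV_sum)
      fix n
      have *: "poly (falling_poly (Suc \<gamma>)) (of_nat n)
             = poly (falling_poly \<gamma>) (of_nat n) * of_nat (n - \<gamma>)"
        by (cases "\<gamma> \<le> n")
           (simp_all add: falling_poly_Suc of_nat_diff poly_falling_poly_eq_0 algebra_simps)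
      show "((\<lambda>z. of_real (b (int n)) * poly (falling_poly \<gamma>) (of_nat n) * z ^ (n - \<gamma>))
          has_field_derivative
          of_real (b (int n)) * poly (falling_poly (Suc \<gamma>)) (of_nat n) * z ^ (n - Suc \<gamma>)) (at z)"
        unfolding * by (auto intro!: derivative_eq_intros)
    qed
    with Suc show ?case by simp
  qed
  then have "v ^ \<gamma> * (deriv ^^ \<gamma>) (mask_symbol b) v
      = (\<Sum>n\<le>N. of_real (b (int n)) * poly (falling_poly \<gamma>) (of_nat n) * (v ^ \<gamma> * v ^ (n - \<gamma>)))"
    by (simp add: sum_distrib_left mult_ac)
  also have "\<dots> = (\<Sum>n\<le>N. of_real (b (int n)) * poly (falling_poly \<gamma>) (of_nat n) * v ^ n)"
  proof (intro sum.cong refl)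
    fix n
    show "of_real (b (int n)) * poly (falling_poly \<gamma>) (of_nat n) * (v ^ \<gamma> * v ^ (n - \<gamma>))
        = of_real (b (int n)) * poly (falling_poly \<gamma>) (of_nat n) * v ^ n"
      by (cases "\<gamma> \<le> n") (simp_all add: power_add[symmetric] poly_falling_poly_eq_0)
  qed
  finally show ?thesis .
qed

text \<open>The weights of the quadrature rules. The factor \<open>exp (- \<nu> n)\<close> comes from evaluating the symbol at
  \<open>\<epsilon> exp (- \<nu>)\<close>; the normalization by \<open>exp (\<nu> y)\<close> makes the target value \<open>P(y)\<close>.\<close>

definition modulated_mask :: "(int \<Rightarrow> real) \<Rightarrow> complex \<Rightarrow> real \<Rightarrow> nat \<Rightarrow> complex" where
  "modulated_mask b \<nu> y n = of_real (b (int n)) * exp (- \<nu> * (of_nat n - of_real y))"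

text \<open>At the points \<open>\<epsilon> exp (- \<nu>)\<close> both sides carry the common factor \<open>exp (- \<nu> y)\<close>; without it, the
  left-hand side is the Fourier transform of the class sums of the weights times \<open>q\<^sub>\<gamma>\<close>.\<close>

lemma symbol_condition_iff:
  assumes "1 \<le> m" "mask_supported b N"
  shows "(\<forall>\<epsilon>\<in>unity_roots m.
            (\<epsilon> * exp (- \<nu>)) ^ \<gamma> * (deriv ^^ \<gamma>) (mask_symbol b) (\<epsilon> * exp (- \<nu>)) =
            (if \<epsilon> = 1 then of_nat m * exp (- \<nu> * of_real y) * of_real (q_poly \<gamma> y) else 0)) \<longleftrightarrow>
         (\<forall>r<m. (\<Sum>n\<in>residue_upto N m r.
                    modulated_mask b \<nu> y n * poly (falling_poly \<gamma>) (of_nat n))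
              = poly (falling_poly \<gamma>) (of_real y))"
proof -
  define d where "d n = modulated_mask b \<nu> y n * poly (falling_poly \<gamma>) (of_nat n)" for n
  define T where "T = poly (falling_poly \<gamma>) (of_real y)"
  define E where "E = exp (- \<nu> * of_real y)"
  have "exp (- \<nu>) ^ n = E * exp (- \<nu> * (of_nat n - of_real y))" for n
    by (simp add: E_def exp_of_nat_mult[symmetric] exp_add[symmetric] algebra_simps)
  then have lhs: "(\<epsilon> * exp (- \<nu>)) ^ \<gamma> * (deriv ^^ \<gamma>) (mask_symbol b) (\<epsilon> * exp (- \<nu>))
      = E * (\<Sum>n\<le>N. d n * \<epsilon> ^ n)" for \<epsilon>
    unfolding power_mult_higher_deriv_symbol[OF assms(2)]
    by (simp add: d_def modulated_mask_def sum_distrib_left power_mult_distrib mult_ac)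
  have rhs: "(if \<epsilon> = 1 then of_nat m * exp (- \<nu> * of_real y) * of_real (q_poly \<gamma> y) else 0)
      = E * (if \<epsilon> = 1 then of_nat m * T else 0)" for \<epsilon> :: complex
    by (simp add: E_def T_def poly_falling_poly_of_real)
  have "E \<noteq> 0" by (simp add: E_def)
  then show ?thesis
    unfolding lhs rhs d_def[symmetric] T_def[symmetric] mult_cancel_left
    using residue_class_sums_iff[OF assms(1), where d = d and N = N and T = T] by simp
qed

section \<open>Subdividing samples of exponential monomials\<close>

text \<open>The substitution \<open>n = \<alpha> - m\<beta>\<close>: the index \<open>\<alpha>\<close> sees exactly the mask entries in its residue class.\<close>

lemma subdivision_op_eq:
  assumes "1 \<le> m" "mask_supported b N"
  shows "subdivision_op m b f \<alpha> =
    (\<Sum>n\<in>residue_upto N m (nat (\<alpha> mod int m)).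
        of_real (b (int n)) * f ((\<alpha> - int n) div int m))"
proof -
  let ?R = "residue_upto N m (nat (\<alpha> mod int m))"
  have dvd: "int m dvd \<alpha> - int n \<longleftrightarrow> n mod m = nat (\<alpha> mod int m)" for n
  proof -
    have "int m dvd \<alpha> - int n \<longleftrightarrow> \<alpha> mod int m = int (n mod m)"
      by (simp add: mod_eq_dvd_iff of_nat_mod)
    also have "\<dots> \<longleftrightarrow> n mod m = nat (\<alpha> mod int m)"
      using assms(1) by auto
    finally show ?thesis .
  qed
  have "subdivision_op m b f \<alpha> =
      (\<Sum>n | n \<in> ?R \<and> b (int n) \<noteq> 0. of_real (b (int n)) * f ((\<alpha> - int n) div int m))"
    unfolding subdivision_op_def
  proof (rule sum.reindex_bij_witness[where j = "\<lambda>\<beta>. nat (\<alpha> - int m * \<beta>)"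
        and i = "\<lambda>n. (\<alpha> - int n) div int m"])
    fix \<beta> assume "\<beta> \<in> {\<beta>. b (\<alpha> - int m * \<beta>) \<noteq> 0}"
    then have b: "b (\<alpha> - int m * \<beta>) \<noteq> 0" and
      "0 \<le> \<alpha> - int m * \<beta>" "\<alpha> - int m * \<beta> \<le> int N"
      using assms(2) by (auto simp: mask_supported_def)
    then have n: "int (nat (\<alpha> - int m * \<beta>)) = \<alpha> - int m * \<beta>" "nat (\<alpha> - int m * \<beta>) \<le> N"
      by auto
    show "(\<alpha> - int (nat (\<alpha> - int m * \<beta>))) div int m = \<beta>"
      using n(1) assms(1) by simp
    show "nat (\<alpha> - int m * \<beta>) \<in> {n. n \<in> ?R \<and> b (int n) \<noteq> 0}"
      using b n dvd[of "nat (\<alpha> - int m * \<beta>)"] by (simp add: residue_upto_def)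
    show "of_real (b (int (nat (\<alpha> - int m * \<beta>)))) * f ((\<alpha> - int (nat (\<alpha> - int m * \<beta>))) div int m)
        = of_real (b (\<alpha> - int m * \<beta>)) * f \<beta>"
      using n(1) assms(1) by simp
  next
    fix n assume n: "n \<in> {n. n \<in> ?R \<and> b (int n) \<noteq> 0}"
    then have "int m dvd \<alpha> - int n"
      using dvd by (simp add: residue_upto_def)
    then have *: "\<alpha> - int m * ((\<alpha> - int n) div int m) = int n"
      by simp
    show "nat (\<alpha> - int m * ((\<alpha> - int n) div int m)) = n"
      using * by simp
    show "(\<alpha> - int n) div int m \<in> {\<beta>. b (\<alpha> - int m * \<beta>) \<noteq> 0}"
      using * n by simp
  qed
  also have "\<dots> = (\<Sum>n\<in>?R. of_real (b (int n)) * f ((\<alpha> - int n) div int m))"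
    by (rule sum.mono_neutral_left) auto
  finally show ?thesis .
qed

lemma subdivision_op_linear:
  assumes "1 \<le> m" "mask_supported b N"
  shows "subdivision_op m b (\<lambda>\<beta>. c * f \<beta> + d * g \<beta>) \<alpha>
       = c * subdivision_op m b f \<alpha> + d * subdivision_op m b g \<alpha>"
  by (simp add: subdivision_op_eq[OF assms] sum.distrib sum_distrib_left algebra_simps)

definition exp_monomial :: "nat \<Rightarrow> complex \<Rightarrow> real \<Rightarrow> complex" where
  "exp_monomial \<gamma> \<mu> x = of_real x ^ \<gamma> * exp (\<mu> * of_real x)"

text \<open>The sample point belonging to \<open>\<beta> = (\<alpha> - n) / m\<close> at level \<open>k\<close> is \<open>(s - n) / m\<^sup>k\<^sup>+\<^sup>1\<close> with
  \<open>s = \<alpha> + m\<tau>\<close>, and the point of \<open>\<alpha>\<close> at level \<open>k + 1\<close> is \<open>(s - y) / m\<^sup>k\<^sup>+\<^sup>1\<close>. So the exponentials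
  differ by the factor that the weights contain.\<close>

lemma exp_monomial_step_iff:
  fixes \<tau> :: real
  assumes "1 \<le> m" "mask_supported b N"
  defines "y \<equiv> of_nat m * \<tau> - \<tau>"
  shows "subdivision_op m b (\<lambda>\<beta>. exp_monomial \<gamma> \<mu> (param_point m \<tau> k \<beta>)) \<alpha>
           = exp_monomial \<gamma> \<mu> (param_point m \<tau> (Suc k) \<alpha>) \<longleftrightarrow>
         (\<Sum>n\<in>residue_upto N m (nat (\<alpha> mod int m)).
            modulated_mask b (\<mu> / of_nat m ^ (k + 1)) y n
              * (of_int \<alpha> + of_nat m * of_real \<tau> - of_nat n) ^ \<gamma>)
           = (of_int \<alpha> + of_nat m * of_real \<tau> - of_real y) ^ \<gamma>"
proof -
  let ?R = "residue_upto N m (nat (\<alpha> mod int m))"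
  define h :: complex where "h = 1 / of_nat m ^ (k + 1)"
  define s :: complex where "s = of_int \<alpha> + of_nat m * of_real \<tau>"
  define E where "E = h ^ \<gamma> * exp (\<mu> * h * (s - of_real y))"
  have "h \<noteq> 0" using assms(1) by (simp add: h_def)
  then have "E \<noteq> 0" by (simp add: E_def)
  have rhs: "exp_monomial \<gamma> \<mu> (param_point m \<tau> (Suc k) \<alpha>) = E * (s - of_real y) ^ \<gamma>"
  proof -
    have "of_real (param_point m \<tau> (Suc k) \<alpha>) = h * (s - of_real y)"
      by (simp add: param_point_def h_def s_def y_def)
    then show ?thesis
      by (simp add: exp_monomial_def E_def power_mult_distrib mult_ac)
  qed
  have "of_real (b (int n)) * exp_monomial \<gamma> \<mu> (param_point m \<tau> k ((\<alpha> - int n) div int m))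
      = E * (modulated_mask b (\<mu> / of_nat m ^ (k + 1)) y n * (s - of_nat n) ^ \<gamma>)"
    if "n \<in> ?R" for n
  proof -
    have "int n mod int m = \<alpha> mod int m"
      using that assms(1) by (simp add: residue_upto_def of_nat_mod[symmetric])
    then have "\<alpha> - int n = int m * ((\<alpha> - int n) div int m)"
      by (metis dvd_mult_div_cancel mod_eq_dvd_iff)
    then have "real_of_int \<alpha> - real n = real m * of_int ((\<alpha> - int n) div int m)"
      by (metis of_int_diff of_int_mult of_int_of_nat_eq)
    then have "param_point m \<tau> k ((\<alpha> - int n) div int m)
        = (of_int \<alpha> + of_nat m * \<tau> - of_nat n) / of_nat m ^ (k + 1)"
      using assms(1) by (simp add: param_point_def field_simps)
    then have pt: "complex_of_real (param_point m \<tau> k ((\<alpha> - int n) div int m)) = h * (s - of_nat n)"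
      by (simp add: h_def s_def)
    have "exp (\<mu> * (h * (s - of_nat n)))
        = exp (\<mu> * h * (s - of_real y)) * exp (- (\<mu> * h) * (of_nat n - of_real y))"
      by (simp add: exp_add[symmetric] algebra_simps)
    moreover have "\<mu> / of_nat m ^ (k + 1) = \<mu> * h"
      by (simp add: h_def)
    ultimately show ?thesis
      unfolding exp_monomial_def pt modulated_mask_def E_def
      by (simp add: power_mult_distrib mult_ac)
  qed
  then have "subdivision_op m b (\<lambda>\<beta>. exp_monomial \<gamma> \<mu> (param_point m \<tau> k \<beta>)) \<alpha>
      = E * (\<Sum>n\<in>?R. modulated_mask b (\<mu> / of_nat m ^ (k + 1)) y n * (s - of_nat n) ^ \<gamma>)"
    unfolding subdivision_op_eq[OF assms(1,2)] sum_distrib_left by (intro sum.cong) auto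
  with rhs \<open>E \<noteq> 0\<close> show ?thesis
    by (simp add: s_def)
qed

definition step_reproduces ::
  "nat \<Rightarrow> (nat \<Rightarrow> int \<Rightarrow> real) \<Rightarrow> real \<Rightarrow> (real \<Rightarrow> complex) \<Rightarrow> bool" where
  "step_reproduces m a \<tau> p \<longleftrightarrow>
     (\<forall>l \<alpha>. subdivision_op m (a l) (\<lambda>\<beta>. p (param_point m \<tau> l \<beta>)) \<alpha>
           = p (param_point m \<tau> (Suc l) \<alpha>))"

lemma symbol_conditions_iff:
  assumes "2 \<le> m" "\<And>k. mask_supported (a k) (N k)"
  shows "symbol_conditions m a \<Gamma> \<Lambda> \<tau> \<longleftrightarrow>
    (\<forall>k. \<forall>\<gamma>\<in>\<Gamma>. \<forall>\<mu>\<in>\<Lambda>. \<forall>r<m.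
       (\<Sum>n\<in>residue_upto (N k) m r.
          modulated_mask (a k) (\<mu> / of_nat m ^ (k + 1)) (of_nat m * \<tau> - \<tau>) n
            * poly (falling_poly \<gamma>) (of_nat n))
       = poly (falling_poly \<gamma>) (of_real (of_nat m * \<tau> - \<tau>)))"
proof -
  have "1 \<le> m" using assms(1) by simp
  have *: "- \<mu> / of_nat m ^ (k + 1) = - (\<mu> / of_nat m ^ (k + 1))" for \<mu> :: complex and k
    by simp
  show ?thesis
    unfolding symbol_conditions_def Let_def *
    by (simp only: symbol_condition_iff[OF \<open>1 \<le> m\<close> assms(2)])
qed

text \<open>The indices \<open>\<alpha> = m i + r\<close> provide infinitely many values of \<open>s\<close> for one and the same
  residue class. Thus reproduction of a single exponential monomial of order \<open>\<gamma>\<close> already yields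
  exactness in all lower degrees.\<close>

lemma step_reproduces_imp_exact:
  assumes "2 \<le> m" "\<And>k. mask_supported (a k) (N k)"
    and "step_reproduces m a \<tau> (exp_monomial \<gamma> \<mu>)" and "r < m"
  shows "exact_to_degree (residue_upto (N k) m r)
    (modulated_mask (a k) (\<mu> / of_nat m ^ (k + 1)) (of_nat m * \<tau> - \<tau>))
    (of_real (of_nat m * \<tau> - \<tau>)) \<gamma>"
proof (rule exact_to_degree_shifted_powers)
  let ?s = "\<lambda>i. of_int (int m * i + int r) + of_nat m * of_real \<tau> :: complex"
  have "inj ?s"
    using assms(1) by (auto intro!: injI)
  then show "infinite (range ?s)"
    using finite_imageD infinite_UNIV_int by blast
  fix s assume "s \<in> range ?s"
  then obtain i where s: "s = ?s i" by blast
  have "nat ((int m * i + int r) mod int m) = r"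
    using assms(4) by simp
  then show "(\<Sum>n\<in>residue_upto (N k) m r.
        modulated_mask (a k) (\<mu> / of_nat m ^ (k + 1)) (of_nat m * \<tau> - \<tau>) n * (s - of_nat n) ^ \<gamma>)
      = (s - of_real (of_nat m * \<tau> - \<tau>)) ^ \<gamma>"
    using assms(1,3) exp_monomial_step_iff[OF _ assms(2)[of k], of m \<gamma> \<mu> \<tau> k "int m * i + int r"]
    unfolding step_reproduces_def s by simp
qed

lemma exact_imp_step_reproduces:
  assumes "2 \<le> m" "\<And>k. mask_supported (a k) (N k)"
    and "\<And>k r. r < m \<Longrightarrow> exact_to_degree (residue_upto (N k) m r)
      (modulated_mask (a k) (\<mu> / of_nat m ^ (k + 1)) (of_nat m * \<tau> - \<tau>))
      (of_real (of_nat m * \<tau> - \<tau>)) \<gamma>"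
  shows "step_reproduces m a \<tau> (exp_monomial \<gamma> \<mu>)"
  unfolding step_reproduces_def
proof (intro allI)
  fix l \<alpha>
  let ?p = "[:of_int \<alpha> + of_nat m * of_real \<tau>, - 1:] ^ \<gamma> :: complex poly"
  have "nat (\<alpha> mod int m) < m" using assms(1) by (simp add: nat_less_iff)
  moreover have "degree ?p \<le> \<gamma>"
    by (simp add: degree_power_eq)
  ultimately show "subdivision_op m (a l) (\<lambda>\<beta>. exp_monomial \<gamma> \<mu> (param_point m \<tau> l \<beta>)) \<alpha>
      = exp_monomial \<gamma> \<mu> (param_point m \<tau> (Suc l) \<alpha>)"
    using assms(1) exp_monomial_step_iff[OF _ assms(2)[of l], of m \<gamma> \<mu> \<tau> l \<alpha>]
      assms(3)[of "nat (\<alpha> mod int m)" l, unfolded exact_to_degree_def, rule_format, of ?p]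
    by simp
qed

section \<open>Stepwise reproduction and reproduction in the limit\<close>

lemma subdivide_linear:
  assumes "1 \<le> m" "\<And>k. mask_supported (a k) (N k)"
  shows "subdivide m a (\<lambda>\<beta>. c * f \<beta> + d * g \<beta>) k
       = (\<lambda>\<alpha>. c * subdivide m a f k \<alpha> + d * subdivide m a g k \<alpha>)"
  by (induction k) (simp_all add: subdivision_op_linear[OF assms])

text \<open>The first step can be split off: it turns data of level \<open>l\<close> into initial data of the scheme that
  starts at level \<open>l + 1\<close>.\<close>

lemma subdivide_shifted_masks_Suc:
  "subdivide m (shifted_masks l a) f (Suc k)
   = subdivide m (shifted_masks (Suc l) a) (subdivision_op m (a l) f) k"
  by (induction k) (simp_all add: shifted_masks_def)

lemma pl_interpolant_rescale:
  "pl_interpolant m \<tau> (l + k) f x = pl_interpolant m \<tau> k f (of_nat m ^ l * x)"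
  by (simp add: pl_interpolant_def power_add mult_ac)

lemma pl_interpolant_linear:
  "pl_interpolant m \<tau> k (\<lambda>\<beta>. c * f \<beta> + d * g \<beta>) x
   = c * pl_interpolant m \<tau> k f x + d * pl_interpolant m \<tau> k g x"
  by (simp add: pl_interpolant_def Let_def algebra_simps)

lemma step_reproduces_subdivide:
  assumes "step_reproduces m a \<tau> p"
  shows "subdivide m (shifted_masks l a) (\<lambda>\<alpha>. p (param_point m \<tau> l \<alpha>)) k
       = (\<lambda>\<alpha>. p (param_point m \<tau> (l + k) \<alpha>))"
proof -
  have "subdivision_op m (a l) (\<lambda>\<beta>. p (param_point m \<tau> l \<beta>))
      = (\<lambda>\<alpha>. p (param_point m \<tau> (Suc l) \<alpha>))" for l
    using assms by (simp add: step_reproduces_def fun_eq_iff)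
  then show ?thesis
    by (induction k) (simp_all add: shifted_masks_def)
qed

text \<open>Both knots around \<open>x\<close> are within distance \<open>m\<^sup>-\<^sup>k\<close> of \<open>x\<close>, and the interpolant is a convex combination
  of the values of \<open>p\<close> there.\<close>

lemma pl_interpolant_samples_tendsto:
  assumes "2 \<le> m" "isCont p x"
  shows "(\<lambda>k. pl_interpolant m \<tau> k (\<lambda>\<alpha>. p (param_point m \<tau> k \<alpha>)) x) \<longlonglongrightarrow> p x"
proof -
  define s where "s k = real m ^ k * x - \<tau>" for k
  define t where "t k = param_point m \<tau> k \<lfloor>s k\<rfloor>" for k
  define u where "u k = param_point m \<tau> k (\<lfloor>s k\<rfloor> + 1)" for k
  have m: "real m ^ k > 0" for k using assms(1) by simp
  have h: "(\<lambda>k. 1 / real m ^ k) \<longlonglongrightarrow> 0"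
    using LIMSEQ_divide_realpow_zero[of "real m" 1] assms(1) by simp
  have t_eq: "t k = x - frac (s k) * (1 / real m ^ k)" for k
    using m[of k] by (simp add: t_def param_point_def frac_def s_def field_simps)
  have u_eq: "u k = t k + 1 / real m ^ k" for k
    by (simp add: u_def t_def param_point_def add_divide_distrib)
  have bd: "Bfun (\<lambda>k. frac (s k)) sequentially"
    by (rule BfunI[where K = 1]) (auto intro!: always_eventually simp: frac_ge_0 less_imp_le[OF frac_lt_1])
  have "(\<lambda>k. frac (s k) * (1 / real m ^ k)) \<longlonglongrightarrow> 0"
    using bounded_bilinear.Bfun_prod_Zfun[OF bounded_bilinear_mult bd] h
    by (simp only: tendsto_Zfun_iff diff_0_right)
  from tendsto_diff[OF tendsto_const[of x] this] have t: "t \<longlonglongrightarrow> x"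
    unfolding t_eq[abs_def] by simp
  from tendsto_add[OF this h] have u: "u \<longlonglongrightarrow> x"
    unfolding u_eq[abs_def] by simp
  have pt: "(\<lambda>k. p (t k)) \<longlonglongrightarrow> p x" and pu: "(\<lambda>k. p (u k)) \<longlonglongrightarrow> p x"
    using isCont_tendsto_compose[OF assms(2)] t u by auto
  from tendsto_diff[OF pu pt] have d: "(\<lambda>k. p (u k) - p (t k)) \<longlonglongrightarrow> 0"
    by simp
  have bd': "Bfun (\<lambda>k. complex_of_real (frac (s k))) sequentially"
    by (rule BfunI[where K = 1]) (auto intro!: always_eventually simp: frac_ge_0 less_imp_le[OF frac_lt_1])
  have "(\<lambda>k. complex_of_real (frac (s k)) * (p (u k) - p (t k))) \<longlonglongrightarrow> 0"
    using bounded_bilinear.Bfun_prod_Zfun[OF bounded_bilinear_mult bd'] d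
    by (simp only: tendsto_Zfun_iff diff_0_right)
  from tendsto_add[OF pt this]
  have "(\<lambda>k. p (t k) + of_real (frac (s k)) * (p (u k) - p (t k))) \<longlonglongrightarrow> p x"
    by simp
  then show ?thesis
    unfolding pl_interpolant_def Let_def s_def[symmetric] t_def[symmetric] u_def[symmetric]
    by (simp add: algebra_simps)
qed

lemma step_reproduces_imp_converges_weakly:
  assumes "2 \<le> m" "continuous_on UNIV p" "step_reproduces m a \<tau> p"
  shows "converges_weakly
          (\<lambda>k. pl_interpolant m \<tau> (l + k + 1)
                 (subdivide m (shifted_masks l a) (\<lambda>\<alpha>. p (param_point m \<tau> l \<alpha>)) (k + 1))) p"
  unfolding converges_weakly_def
proof (intro conjI allI)
  fix x
  have "isCont p x"
    using assms(2) by (simp add: continuous_on_eq_continuous_at)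
  from pl_interpolant_samples_tendsto[OF assms(1) this, of \<tau>]
  have "(\<lambda>k. pl_interpolant m \<tau> (k + (l + 1))
            (\<lambda>\<alpha>. p (param_point m \<tau> (k + (l + 1)) \<alpha>)) x) \<longlonglongrightarrow> p x"
    by (rule LIMSEQ_ignore_initial_segment)
  then show "(\<lambda>k. pl_interpolant m \<tau> (l + k + 1)
      (subdivide m (shifted_masks l a) (\<lambda>\<alpha>. p (param_point m \<tau> l \<alpha>)) (k + 1)) x) \<longlonglongrightarrow> p x"
    unfolding step_reproduces_subdivide[OF assms(3)] by (simp add: add_ac)
  have "compact (p ` cball x 1)"
    by (rule compact_continuous_image) (use assms(2) continuous_on_subset in auto)
  then have "bounded (p ` ball x 1)"
    by (rule bounded_subset[OF compact_imp_bounded]) auto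
  then show "\<exists>r>0. bounded (p ` ball x r)"
    using zero_less_one by blast
qed

text \<open>This is where non-singularity enters. In the scheme that starts at level \<open>l + 1\<close>, the data
  obtained from the samples at level \<open>l\<close> by one step and the samples at level \<open>l + 1\<close> both lead to
  \<open>p\<close>, up to the dilation by \<open>m\<^sup>l\<^sup>+\<^sup>1\<close> that resets the level to \<open>0\<close>.\<close>

lemma reproduced_imp_step_reproduces:
  assumes "2 \<le> m" and supp: "\<And>k. mask_supported (a k) (N k)"
    and nonsing: "non_singular_scheme m \<tau> a"
    and conv: "\<And>l. converges_weakly
          (\<lambda>k. pl_interpolant m \<tau> (l + k + 1)
                 (subdivide m (shifted_masks l a) (\<lambda>\<alpha>. p (param_point m \<tau> l \<alpha>)) (k + 1))) p"
  shows "step_reproduces m a \<tau> p"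
proof -
  have "(\<lambda>\<alpha>. subdivision_op m (a l) (\<lambda>\<beta>. p (param_point m \<tau> l \<beta>)) \<alpha>
          - p (param_point m \<tau> (Suc l) \<alpha>)) = (\<lambda>\<alpha>. 0)" (is "?h = _") for l
  proof -
    let ?A = "shifted_masks (Suc l) a"
    let ?f = "subdivision_op m (a l) (\<lambda>\<beta>. p (param_point m \<tau> l \<beta>))"
    let ?g = "\<lambda>\<alpha>. p (param_point m \<tau> (Suc l) \<alpha>)"
    have suppA: "mask_supported (?A k) (N (Suc l + k))" for k
      using supp by (simp add: shifted_masks_def)
    have resc: "pl_interpolant m \<tau> (Suc l + k) F (x / of_nat m ^ Suc l) = pl_interpolant m \<tau> k F x"
      for k F x
      unfolding pl_interpolant_rescale using assms(1) by simp
    have f: "(\<lambda>k. scheme_functions m \<tau> ?A ?f k x) \<longlonglongrightarrow> p (x / of_nat m ^ Suc l)" for x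
    proof -
      have "(\<lambda>k. pl_interpolant m \<tau> (Suc l + k) (subdivide m ?A ?f k) (x / of_nat m ^ Suc l))
          \<longlonglongrightarrow> p (x / of_nat m ^ Suc l)"
        using conv[of l] unfolding converges_weakly_def
        by (simp only: subdivide_shifted_masks_Suc Suc_eq_plus1[symmetric] add_Suc)
      then show ?thesis
        unfolding resc scheme_functions_def .
    qed
    have g: "(\<lambda>k. scheme_functions m \<tau> ?A ?g k x) \<longlonglongrightarrow> p (x / of_nat m ^ Suc l)" for x
    proof -
      \<comment> \<open>Reproduction speaks of at least one step, so the limit is known for the index \<open>Suc k\<close>.\<close>
      have "(\<lambda>k. pl_interpolant m \<tau> (Suc l + Suc k) (subdivide m ?A ?g (Suc k))
              (x / of_nat m ^ Suc l)) \<longlonglongrightarrow> p (x / of_nat m ^ Suc l)"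
        using conv[of "Suc l"] unfolding converges_weakly_def
        by (simp only: Suc_eq_plus1[symmetric] add_Suc add_Suc_right)
      then show ?thesis
        unfolding resc scheme_functions_def by (rule LIMSEQ_imp_Suc)
    qed
    have "scheme_functions m \<tau> ?A ?h k x
        = scheme_functions m \<tau> ?A ?f k x - scheme_functions m \<tau> ?A ?g k x" for k x
      using subdivide_linear[OF _ suppA, where m = m and c = 1 and f = ?f and d = "-1" and g = ?g and k = k] assms(1)
        pl_interpolant_linear[where c = 1 and f = "subdivide m ?A ?f k" and d = "-1"
          and g = "subdivide m ?A ?g k"]
      by (simp add: scheme_functions_def)
    then have "(\<lambda>k. scheme_functions m \<tau> ?A ?h k x) \<longlonglongrightarrow> 0" for x
      using tendsto_diff[OF f[of x] g[of x]] by simp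
    then have "limit_function m \<tau> ?A ?h = (\<lambda>x. 0)"
      by (intro ext) (simp add: limit_function_def limI)
    then show ?thesis
      using nonsing unfolding non_singular_scheme_def by blast
  qed
  then show ?thesis
    unfolding step_reproduces_def fun_eq_iff by simp
qed

lemma exp_monomial_in_EP: "\<gamma> \<in> \<Gamma> \<Longrightarrow> \<mu> \<in> \<Lambda> \<Longrightarrow> exp_monomial \<gamma> \<mu> \<in> EP \<Gamma> \<Lambda>"
  unfolding EP_def
  by (rule module.span_base[OF module_complex_functions]) (auto simp: exp_monomial_def fun_eq_iff)

text \<open>Subdivision is linear and continuity is preserved by linear combinations, so it suffices to treat
  the spanning functions.\<close>

lemma step_reproduces_EP:
  assumes "2 \<le> m" "\<And>k. mask_supported (a k) (N k)"
    and "\<And>\<gamma> \<mu>. \<gamma> \<in> \<Gamma> \<Longrightarrow> \<mu> \<in> \<Lambda> \<Longrightarrow> step_reproduces m a \<tau> (exp_monomial \<gamma> \<mu>)"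
    and "p \<in> EP \<Gamma> \<Lambda>"
  shows "continuous_on UNIV p \<and> step_reproduces m a \<tau> p"
  using assms(4) unfolding EP_def
proof (induction rule: module.span_induct[OF module_complex_functions, consumes 1])
  case 1
  have lin: "subdivision_op m (a l) (\<lambda>\<beta>. c * f \<beta> + d * g \<beta>) \<alpha>
       = c * subdivision_op m (a l) f \<alpha> + d * subdivision_op m (a l) g \<alpha>" for l c f d g \<alpha>
    using subdivision_op_linear[OF _ assms(2)] assms(1) by simp
  show ?case
    unfolding module.subspace_def[OF module_complex_functions]
    using lin[where c = 0 and d = 0] lin[where c = 1 and d = 1] lin[where d = 0]
    by (auto simp: step_reproduces_def zero_fun_def plus_fun_def intro!: continuous_intros)
next
  case (2 p)
  then obtain \<gamma> \<mu> where "\<gamma> \<in> \<Gamma>" "\<mu> \<in> \<Lambda>" "p = exp_monomial \<gamma> \<mu>"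
    by (auto simp: exp_monomial_def fun_eq_iff)
  moreover have "continuous_on UNIV (exp_monomial \<gamma> \<mu>)"
    unfolding exp_monomial_def by (intro continuous_intros)
  ultimately show ?case
    using assms(3) by simp
qed

theorem theorem4p4:
  fixes m :: nat and \<Gamma> :: "nat set" and \<Lambda> :: "complex set" and a :: "nat \<Rightarrow> int \<Rightarrow> real"
  assumes "2 \<le> m"
    and "scheme_masks a"
    and "\<forall>\<tau>. non_singular_scheme m \<tau> a"
  shows "(reproduces_EP m a \<Gamma> \<Lambda> \<longrightarrow> (\<exists>\<tau>. symbol_conditions m a \<Gamma> \<Lambda> \<tau>)) \<and>
         ((\<forall>\<gamma>\<in>\<Gamma>. {..\<gamma>} \<subseteq> \<Gamma>) \<longrightarrow>
           (reproduces_EP m a \<Gamma> \<Lambda> \<longleftrightarrow> (\<exists>\<tau>. symbol_conditions m a \<Gamma> \<Lambda> \<tau>)))"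
proof -
  from assms(2) obtain N where N: "\<And>k. mask_supported (a k) (N k)"
    unfolding scheme_masks_def mask_supported_def by metis
  have necessary: "\<exists>\<tau>. symbol_conditions m a \<Gamma> \<Lambda> \<tau>" if "reproduces_EP m a \<Gamma> \<Lambda>"
  proof -
    from that obtain \<tau> where conv: "\<And>p l. p \<in> EP \<Gamma> \<Lambda> \<Longrightarrow> converges_weakly
          (\<lambda>k. pl_interpolant m \<tau> (l + k + 1)
                 (subdivide m (shifted_masks l a) (\<lambda>\<alpha>. p (param_point m \<tau> l \<alpha>)) (k + 1))) p"
      unfolding reproduces_EP_def by blast
    have "step_reproduces m a \<tau> (exp_monomial \<gamma> \<mu>)" if "\<gamma> \<in> \<Gamma>" "\<mu> \<in> \<Lambda>" for \<gamma> \<mu>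
      by (rule reproduced_imp_step_reproduces[OF assms(1) N])
         (use assms(3) conv exp_monomial_in_EP[OF that] in auto)
    note exact = step_reproduces_imp_exact[of m a N, OF assms(1) N this]
    have "symbol_conditions m a \<Gamma> \<Lambda> \<tau>"
      unfolding symbol_conditions_iff[of m a N, OF assms(1) N]
    proof (intro allI ballI impI)
      fix k \<gamma> \<mu> r assume "\<gamma> \<in> \<Gamma>" "\<mu> \<in> \<Lambda>" "r < m"
      from exact[OF this, of k] show "(\<Sum>n\<in>residue_upto (N k) m r.
            modulated_mask (a k) (\<mu> / of_nat m ^ (k + 1)) (of_nat m * \<tau> - \<tau>) n
              * poly (falling_poly \<gamma>) (of_nat n))
          = poly (falling_poly \<gamma>) (of_real (of_nat m * \<tau> - \<tau>))"
        unfolding exact_to_degree_def using degree_falling_poly by simp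
    qed
    then show ?thesis ..
  qed
  have sufficient: "reproduces_EP m a \<Gamma> \<Lambda>"
    if closed: "\<forall>\<gamma>\<in>\<Gamma>. {..\<gamma>} \<subseteq> \<Gamma>" and cond: "symbol_conditions m a \<Gamma> \<Lambda> \<tau>" for \<tau>
  proof -
    have "step_reproduces m a \<tau> (exp_monomial \<gamma> \<mu>)" if "\<gamma> \<in> \<Gamma>" "\<mu> \<in> \<Lambda>" for \<gamma> \<mu>
    proof (rule exact_imp_step_reproduces[of m a N, OF assms(1) N])
      fix k r assume "r < m"
      show "exact_to_degree (residue_upto (N k) m r)
          (modulated_mask (a k) (\<mu> / of_nat m ^ (k + 1)) (of_nat m * \<tau> - \<tau>))
          (of_real (of_nat m * \<tau> - \<tau>)) \<gamma>"
      proof (rule exact_to_degree_staircase[OF degree_falling_poly])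
        fix j assume "j \<le> \<gamma>"
        with closed \<open>\<gamma> \<in> \<Gamma>\<close> have "j \<in> \<Gamma>" by auto
        with cond[unfolded symbol_conditions_iff[of m a N, OF assms(1) N]] \<open>\<mu> \<in> \<Lambda>\<close> \<open>r < m\<close>
        show "(\<Sum>n\<in>residue_upto (N k) m r.
              modulated_mask (a k) (\<mu> / of_nat m ^ (k + 1)) (of_nat m * \<tau> - \<tau>) n
                * poly (falling_poly j) (of_nat n))
            = poly (falling_poly j) (of_real (of_nat m * \<tau> - \<tau>))"
          by blast
      qed
    qed
    then have "continuous_on UNIV p \<and> step_reproduces m a \<tau> p" if "p \<in> EP \<Gamma> \<Lambda>" for p
      using step_reproduces_EP[of m a N, OF assms(1) N] that by blast
    then show ?thesis
      unfolding reproduces_EP_def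
      using step_reproduces_imp_converges_weakly[OF assms(1)] by blast
  qed
  show ?thesis
    using necessary sufficient by blast
qed

end
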